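(* For any integer $r\geq 2$, there exists a bounded infinite SOT-discrete group $G\leqslant \mathrm{GL}(c_0)$ of isomorphisms of the real Banach space $c_0$, all of whose elements are of the form $\mathrm{Id}+F$ with $F$ a bounded linear operator on $c_0$ of finite rank, such that $G$ admits a distinguished family of cardinality $r$, but none of cardinality $r-1$.
   Context: $\mathrm{GL}(X)$ is the group of bounded linear isomorphisms of $X$ onto itself; a subgroup is bounded if it is bounded in operator norm, and SOT-discrete if it is discrete in the Strong Operator Topology (pointwise norm convergence on $X$). A finite family $\{x_1,\dots,x_n\}$ of vectors of $X$ is distinguished for $G$ if $\inf_{T\in G,\,T\neq \mathrm{Id}}\max_{1\le i\le n}\|Tx_i-x_i\|>0$. *)

theory Defs
  imports "HOL-Analysis.Analysis" "HOL-Algebra.Group"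
begin

section \<open>The real Banach space of null sequences\<close>

typedef c0 = "{f :: nat \<Rightarrow> real. f \<longlonglongrightarrow> 0}"
  morphisms c0_nth Abs_c0
  by (intro exI[of _ "\<lambda>_. 0"]) simp

setup_lifting type_definition_c0

lemma c0_nth_tendsto: "c0_nth x \<longlonglongrightarrow> 0"
  using c0_nth[of x] by simp

lemma c0_eqI: "(\<And>n. c0_nth x n = c0_nth y n) \<Longrightarrow> x = y"
  by (metis c0_nth_inject ext)

lemma bdd_above_c0: "f \<longlonglongrightarrow> 0 \<Longrightarrow> bdd_above (range (\<lambda>n. \<bar>f n :: real\<bar>))"
  by (metis (no_types, lifting) Bseq_def convergentI convergent_imp_Bseq bdd_aboveI2 real_norm_def)

instantiation c0 :: real_vector
begin

lift_definition zero_c0 :: c0 is "\<lambda>_. 0"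
  by simp

lift_definition plus_c0 :: "c0 \<Rightarrow> c0 \<Rightarrow> c0" is "\<lambda>f g n. f n + g n"
  by (rule tendsto_add_zero)

lift_definition minus_c0 :: "c0 \<Rightarrow> c0 \<Rightarrow> c0" is "\<lambda>f g n. f n - g n"
  using tendsto_diff by fastforce

lift_definition uminus_c0 :: "c0 \<Rightarrow> c0" is "\<lambda>f n. - f n"
  using tendsto_minus by fastforce

lift_definition scaleR_c0 :: "real \<Rightarrow> c0 \<Rightarrow> c0" is "\<lambda>a f n. a * f n"
  by (rule tendsto_mult_right_zero)

instance
  by standard (transfer; simp add: algebra_simps)+

end

instantiation c0 :: real_normed_vector
begin

lift_definition norm_c0 :: "c0 \<Rightarrow> real" is "\<lambda>f. SUP n. \<bar>f n\<bar>" .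

definition dist_c0 :: "c0 \<Rightarrow> c0 \<Rightarrow> real"
  where "dist_c0 x y = norm (x - y)"

definition sgn_c0 :: "c0 \<Rightarrow> c0"
  where "sgn_c0 x = x /\<^sub>R norm x"

definition uniformity_c0 :: "(c0 \<times> c0) filter"
  where "uniformity_c0 = (INF e\<in>{0 <..}. principal {(x, y). dist x y < e})"

definition open_c0 :: "c0 set \<Rightarrow> bool"
  where "open_c0 S = (\<forall>x\<in>S. \<forall>\<^sub>F (x', y) in uniformity. x' = x \<longrightarrow> y \<in> S)"

lemma c0_nth_le_norm: "\<bar>c0_nth x n\<bar> \<le> norm x"
  by transfer (intro cSUP_upper bdd_above_c0 UNIV_I)

lemma norm_c0_le: "(\<And>n. \<bar>c0_nth x n\<bar> \<le> b) \<Longrightarrow> norm x \<le> b"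
  by transfer (auto intro: cSUP_least)

instance
proof
  fix x y :: c0 and a :: real
  show "norm x = 0 \<longleftrightarrow> x = 0"
  proof
    assume "norm x = 0"
    then have "\<And>n. c0_nth x n = 0"
      by (metis c0_nth_le_norm abs_le_zero_iff)
    then show "x = 0"
      by (intro c0_eqI) (simp add: zero_c0.rep_eq)
  qed (transfer, simp)
  show "norm (x + y) \<le> norm x + norm y"
  proof (rule norm_c0_le)
    fix n
    show "\<bar>c0_nth (x + y) n\<bar> \<le> norm x + norm y"
      using c0_nth_le_norm[of x n] c0_nth_le_norm[of y n]
      by (simp add: plus_c0.rep_eq)
  qed
  have le: "norm (a *\<^sub>R x) \<le> \<bar>a\<bar> * norm x"
    for a :: real and x :: c0
    by (rule norm_c0_le) (simp add: scaleR_c0.rep_eq abs_mult mult_left_mono c0_nth_le_norm)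
  show "norm (a *\<^sub>R x) = \<bar>a\<bar> * norm x"
  proof (cases "a = 0")
    case True
    then show ?thesis by (simp, transfer, simp)
  next
    case False
    have "inverse a *\<^sub>R a *\<^sub>R x = x"
      using False by (transfer, simp)
    then have "\<bar>a\<bar> * norm x \<le> norm (a *\<^sub>R x)"
      using le[of "inverse a" "a *\<^sub>R x"] False by (simp add: field_simps)
    with le[of a x] show ?thesis by simp
  qed
qed (rule dist_c0_def sgn_c0_def uniformity_c0_def open_c0_def)+

end

lemma norm_c0_eq: "norm x = (SUP n. \<bar>c0_nth x n\<bar>)"
  by (rule norm_c0.rep_eq)

instance c0 :: banach
proof
  fix X :: "nat \<Rightarrow> c0"
  assume X: "Cauchy X"
  have dist_le: "\<bar>c0_nth x k - c0_nth y k\<bar> \<le> norm (x - y)" for x y k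
    using c0_nth_le_norm[of "x - y" k] by (simp add: minus_c0.rep_eq)
  have "uniformly_Cauchy_on UNIV (\<lambda>n. c0_nth (X n))"
    unfolding uniformly_Cauchy_on_def dist_norm real_norm_def
    by (metis CauchyD[OF X] dist_le order_le_less_trans)
  then obtain f where f: "uniform_limit UNIV (\<lambda>n. c0_nth (X n)) f sequentially"
    using Cauchy_uniformly_convergent uniformly_convergent_on_def by blast
  have "f \<longlonglongrightarrow> 0"
    using swap_uniform_limit'[OF always_eventually tendsto_const f always_eventually]
    by (simp add: c0_nth_tendsto)
  then have nth: "c0_nth (Abs_c0 f) = f"
    by (simp add: Abs_c0_inverse)
  have "X \<longlonglongrightarrow> Abs_c0 f"
  proof (rule LIMSEQ_I)
    fix e :: real
    assume e: "0 < e"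
    then obtain N where N: "\<And>n k. n \<ge> N \<Longrightarrow> \<bar>c0_nth (X n) k - f k\<bar> < e / 2"
      using uniform_limitD[OF f, of "e / 2"]
      by (auto simp: eventually_sequentially dist_real_def)
    have "norm (X n - Abs_c0 f) < e" if "n \<ge> N" for n
    proof -
      have "norm (X n - Abs_c0 f) \<le> e / 2"
        by (rule norm_c0_le) (use N[OF that] in \<open>simp add: minus_c0.rep_eq nth less_imp_le\<close>)
      with e show ?thesis by simp
    qed
    then show "\<exists>N. \<forall>n\<ge>N. norm (X n - Abs_c0 f) < e" by blast
  qed
  then show "convergent X" by (rule convergentI)
qed


section \<open>Groups of isomorphisms\<close>

text \<open>Surjective isomorphisms are taken to be the operators with a bounded two-sided inverse.\<close>

definition GL :: "('a::real_normed_vector \<Rightarrow>\<^sub>L 'a) monoid" where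
  "GL = \<lparr>carrier = {T. \<exists>S. S o\<^sub>L T = id_blinfun \<and> T o\<^sub>L S = id_blinfun},
         mult = (o\<^sub>L), one = id_blinfun\<rparr>"

lemma blinfun_compose_assoc: "(S o\<^sub>L T) o\<^sub>L U = S o\<^sub>L (T o\<^sub>L U)"
  by (rule blinfun_eqI) simp

lemma blinfun_compose_id: "id_blinfun o\<^sub>L T = T" "T o\<^sub>L id_blinfun = T"
  by (rule blinfun_eqI, simp)+

lemma group_GL: "group GL"
proof (rule groupI)
  fix S T :: "'a::real_normed_vector \<Rightarrow>\<^sub>L 'a"
  assume "S \<in> carrier GL" "T \<in> carrier GL"
  then obtain S' T' where "S' o\<^sub>L S = id_blinfun" "S o\<^sub>L S' = id_blinfun"
      "T' o\<^sub>L T = id_blinfun" "T o\<^sub>L T' = id_blinfun"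
    by (auto simp: GL_def)
  then have "(T' o\<^sub>L S') o\<^sub>L (S o\<^sub>L T) = id_blinfun \<and> (S o\<^sub>L T) o\<^sub>L (T' o\<^sub>L S') = id_blinfun"
    by (metis blinfun_compose_assoc blinfun_compose_id)
  then show "S \<otimes>\<^bsub>GL\<^esub> T \<in> carrier GL"
    by (auto simp: GL_def)
qed (auto simp: GL_def blinfun_compose_assoc blinfun_compose_id)

definition SOT_discrete :: "('a::real_normed_vector \<Rightarrow>\<^sub>L 'a) set \<Rightarrow> bool" where
  "SOT_discrete G \<longleftrightarrow> subtopology strong_operator_topology G = discrete_topology G"

definition finite_rank :: "('a::real_normed_vector \<Rightarrow>\<^sub>L 'b::real_normed_vector) \<Rightarrow> bool" where
  "finite_rank F \<longleftrightarrow> (\<exists>B. finite B \<and> range (blinfun_apply F) \<subseteq> span B)"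

text \<open>The infimum is taken in the extended reals, so that it is \<open>\<infinity>\<close> for the trivial group.\<close>

definition distinguished :: "('a::real_normed_vector \<Rightarrow>\<^sub>L 'a) set \<Rightarrow> 'a set \<Rightarrow> bool" where
  "distinguished G X \<longleftrightarrow> finite X \<and> X \<noteq> {} \<and>
     0 < (INF T\<in>G - {id_blinfun}. ereal (MAX x\<in>X. norm (blinfun_apply T x - x)))"

end

theory Submission
  imports Defs
begin

text \<open>
  Choose vectors \<open>F k\<close> on the max-norm unit sphere of \<open>\<real>\<^sup>r\<close> that approximate every point of
  the sphere infinitely often. Reading the first \<open>r\<close> coordinates of \<open>x \<in> c\<^sub>0\<close> as a vector of
  \<open>\<real>\<^sup>r\<close>, the functionals \<open>\<phi> k x = x\<^sub>k + \<langle>F k, (x\<^sub>0, \<dots>, x\<^sub>r\<^sub>-\<^sub>1)\<rangle>\<close> for \<open>k \<ge> r\<close> identify \<open>c\<^sub>0\<close> with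
  the subspace of \<open>\<ell>\<^sub>\<infinity>\<close> spanned by \<open>c\<^sub>0\<close> and the \<open>r\<close> bounded sequences \<open>k \<mapsto> F k i\<close>. The group
  consists of the changes of sign at finitely many coordinates of that subspace. The \<open>r\<close>
  sequences are distinguished because each \<open>F k\<close> has norm 1. Given fewer than \<open>r\<close> vectors,
  some point \<open>v\<close> of the sphere is orthogonal to all their \<open>\<real>\<^sup>r\<close>-components; for large \<open>k\<close> with
  \<open>F k\<close> close to \<open>v\<close>, the sign change at \<open>k\<close> hardly moves any of them.
\<close>

section \<open>Underdetermined homogeneous linear systems\<close>

text \<open>Gaussian elimination, one equation at a time. In \<open>small_\<phi>\<close> it supplies
  a direction orthogonal to the first \<open>r\<close> coordinates of fewer than \<open>r\<close>
  vectors.\<close>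

lemma underdetermined_system_nontrivial:
  fixes a :: "'j \<Rightarrow> 'i \<Rightarrow> 'a::field"
  assumes "finite J" "finite I" "card J < card I"
  obtains v where "\<exists>i\<in>I. v i \<noteq> 0" "\<And>j. j \<in> J \<Longrightarrow> (\<Sum>i\<in>I. a j i * v i) = 0"
proof -
  have "\<exists>v. (\<exists>i\<in>I. v i \<noteq> 0) \<and> (\<forall>j\<in>J. (\<Sum>i\<in>I. a j i * v i) = 0)"
    using assms
  proof (induction J arbitrary: a I rule: finite_induct)
    case empty
    then show ?case
      by (intro exI[of _ "\<lambda>_. 1"]) (auto simp: card_gt_0_iff)
  next
    case (insert j J)
    show ?case
    proof (cases "\<forall>i\<in>I. a j i = 0")
      case True
      have "card J < card I"
        using insert by simp
      then obtain v where "\<exists>i\<in>I. v i \<noteq> 0" "\<forall>j\<in>J. (\<Sum>i\<in>I. a j i * v i) = 0"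
        using insert.IH insert.prems by blast
      with True show ?thesis
        by (intro exI[of _ v]) simp
    next
      case False
      then obtain p where p: "p \<in> I" "a j p \<noteq> 0"
        by blast
      \<comment> \<open>Equation \<open>j\<close> is used to eliminate the unknown \<open>p\<close>
        from the others.\<close>
      define b where "b j' i = a j' i - a j' p * a j i / a j p" for j' i
      have "finite (I - {p})" "card J < card (I - {p})"
        using insert p by simp_all
      then obtain v where v: "\<exists>i\<in>I - {p}. v i \<noteq> 0"
          "\<forall>j\<in>J. (\<Sum>i\<in>I - {p}. b j i * v i) = 0"
        using insert.IH by blast
      define S where "S = (\<Sum>i\<in>I - {p}. a j i * v i)"
      \<comment> \<open>Back substitution: the value at \<open>p\<close> makes equation
        \<open>j\<close> hold.\<close>
      define u where "u = v(p := - S / a j p)"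
      have sum_u: "(\<Sum>i\<in>I. a j' i * u i) = (\<Sum>i\<in>I - {p}. a j' i * v i) - a j' p * S / a j p"
        for j'
      proof -
        have "(\<Sum>i\<in>I. a j' i * u i) = a j' p * u p + (\<Sum>i\<in>I - {p}. a j' i * u i)"
          using insert.prems p by (simp add: sum.remove)
        also have "(\<Sum>i\<in>I - {p}. a j' i * u i) = (\<Sum>i\<in>I - {p}. a j' i * v i)"
          by (rule sum.cong) (auto simp: u_def)
        finally show ?thesis
          by (simp add: u_def)
      qed
      have "(\<Sum>i\<in>I. a j' i * u i) = 0" if "j' \<in> J" for j'
      proof -
        have "0 = (\<Sum>i\<in>I - {p}. b j' i * v i)"
          using v that by simp
        also have "\<dots> = (\<Sum>i\<in>I - {p}. a j' i * v i) - a j' p * S / a j p"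
          by (simp add: b_def S_def algebra_simps sum_subtractf sum_distrib_left sum_divide_distrib)
        finally show ?thesis
          using sum_u by simp
      qed
      moreover have "(\<Sum>i\<in>I. a j i * u i) = 0"
        using p by (simp add: sum_u S_def)
      moreover have "\<exists>i\<in>I. u i \<noteq> 0"
        using v(1) by (auto simp: u_def)
      ultimately show ?thesis
        by (intro exI[of _ u]) simp
    qed
  qed
  then show thesis
    using that by blast
qed

section \<open>Approximating the max-norm sphere infinitely often\<close>

text \<open>Density is asked for with infinitely many indices, since \<open>small_\<phi>\<close>
  needs \<open>F k\<close> near \<open>v\<close> at a \<open>k\<close> so large that the
  \<open>k\<close>-th coordinates of the given vectors are small as well.\<close>

locale twisted_sign_changes =
  fixes r :: nat and F :: "nat \<Rightarrow> nat \<Rightarrow> real"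
  assumes r_pos: "r > 0"
    and F_le: "i < r \<Longrightarrow> \<bar>F k i\<bar> \<le> 1"
    and F_eq: "\<exists>i<r. \<bar>F k i\<bar> = 1"
    and F_dense: "(\<And>i. i < r \<Longrightarrow> \<bar>v i\<bar> \<le> 1) \<Longrightarrow> \<exists>i<r. \<bar>v i\<bar> = 1 \<Longrightarrow> e > 0 \<Longrightarrow>
        infinite {k. \<forall>i<r. \<bar>F k i - v i\<bar> < e}"

lemma exists_twisted_sign_changes:
  assumes "r > 0"
  obtains F where "twisted_sign_changes r F"
proof -
  define good where
    "good = (\<lambda>(N::nat, z::int list). N > 0 \<and> (\<forall>i<r. \<bar>z ! i\<bar> \<le> int N) \<and> (\<exists>i<r. \<bar>z ! i\<bar> = int N))"
  \<comment> \<open>A good code \<open>(N, z)\<close> stands for the rational point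
    \<open>z / N\<close> of the sphere. Every other code yields the all-ones vector, which is on the
    sphere because \<open>r > 0\<close>.\<close>
  define F where
    "F k i = (case from_nat k of (N, z) \<Rightarrow> if good (N, z) then real_of_int (z ! i) / real N else 1)"
    for k i
  have le1: "\<bar>F k i\<bar> \<le> 1" if "i < r" for k i
  proof (cases "from_nat k :: nat \<times> int list")
    case (Pair N z)
    have "\<bar>real_of_int (z ! i)\<bar> \<le> real N" if "good (N, z)"
    proof -
      have "\<bar>z ! i\<bar> \<le> int N"
        using that \<open>i < r\<close> by (simp add: good_def)
      then show ?thesis
        by linarith
    qed
    with Pair show ?thesis
      by (auto simp: F_def good_def divide_le_eq)
  qed
  have eq1: "\<exists>i<r. \<bar>F k i\<bar> = 1" for k
  proof (cases "from_nat k :: nat \<times> int list")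
    case (Pair N z)
    show ?thesis
    proof (cases "good (N, z)")
      case True
      then obtain i where "i < r" "\<bar>z ! i\<bar> = int N" "N > 0"
        by (auto simp: good_def)
      moreover from this have "\<bar>real_of_int (z ! i)\<bar> = real N"
        by linarith
      ultimately show ?thesis
        using True Pair by (auto simp: F_def)
    next
      case False
      then show ?thesis
        using assms Pair by (auto simp: F_def)
    qed
  qed
  have dense: "infinite {k. \<forall>i<r. \<bar>F k i - v i\<bar> < e}"
    if v: "\<And>i. i < r \<Longrightarrow> \<bar>v i\<bar> \<le> 1" "\<exists>i<r. \<bar>v i\<bar> = 1" and e: "e > 0" for v e
  proof -
    obtain M where M: "M > 0" "1 / real M < e"
      using e by (metis nat_approx_posE zero_less_Suc)
    \<comment> \<open>Rounding down keeps the coordinates in \<open>[-N, N]\<close> and is exact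
      where \<open>v i\<close> is 1 or -1, so the rounded point divided by \<open>N\<close> is again
      on the sphere, within \<open>1 / N\<close> of \<open>v\<close>.\<close>
    define z where "z N = map (\<lambda>i. \<lfloor>real N * v i\<rfloor>) [0..<r]" for N
    txt \<open>Since \<open>N\<close> is part of the code, distinct \<open>N\<close> give distinct indices even where the points
      they encode coincide.\<close>
    define code where "code N = to_nat (N, z N)" for N
    have "inj_on code {M..}"
      by (auto simp: inj_on_def code_def)
    then have "infinite (code ` {M..})"
      by (simp add: finite_image_iff infinite_Ici)
    moreover have "\<bar>F (code N) i - v i\<bar> < e" if N: "N \<ge> M" and i: "i < r" for N i
    proof -
      have N0: "N > 0"
        using N M by auto
      have "\<bar>\<lfloor>real N * v i\<rfloor>\<bar> \<le> int N" if "i < r" for i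
      proof -
        have "real N * v i \<le> real N" "- real N \<le> real N * v i"
          using v(1)[OF that] mult_left_mono[of "v i" 1 "real N"] mult_left_mono[of "-1" "v i" "real N"]
          by (auto simp: abs_le_iff)
        then show ?thesis
          by linarith
      qed
      moreover have "\<exists>i<r. \<bar>\<lfloor>real N * v i\<rfloor>\<bar> = int N"
      proof -
        obtain i where i: "i < r" "v i = 1 \<or> v i = - 1"
          using v(2) by (auto simp: abs_if split: if_splits)
        then show ?thesis
          by (intro exI[of _ i]) (auto simp: floor_minus)
      qed
      ultimately have "good (N, z N)"
        using N0 by (auto simp: good_def z_def)
      then have "F (code N) i = real_of_int \<lfloor>real N * v i\<rfloor> / real N"
        using i by (simp add: F_def code_def z_def)
      then have "F (code N) i - v i = (real_of_int \<lfloor>real N * v i\<rfloor> - real N * v i) / real N"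
        using N0 by (simp add: field_simps)
      then have "\<bar>F (code N) i - v i\<bar> = \<bar>real_of_int \<lfloor>real N * v i\<rfloor> - real N * v i\<bar> / real N"
        by simp
      also have "\<dots> \<le> 1 / real N"
        using N0 by (intro divide_right_mono) linarith+
      also have "\<dots> \<le> 1 / real M"
        using N M by (simp add: frac_le)
      finally show ?thesis
        using M by simp
    qed
    then have "code ` {M..} \<subseteq> {k. \<forall>i<r. \<bar>F k i - v i\<bar> < e}"
      by auto
    ultimately show ?thesis
      using finite_subset by blast
  qed
  have "twisted_sign_changes r F"
    using assms le1 eq1 dense by unfold_locales blast+
  then show thesis
    by (rule that)
qed

section \<open>Unit vectors of \<open>c0\<close>\<close>

lift_definition c0_unit :: "nat \<Rightarrow> c0" is "\<lambda>k n. if n = k then 1 else 0"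
  subgoal for k
    by (rule tendsto_eventually, rule eventually_mono[OF eventually_gt_at_top[of k]]) simp
  done

lemma c0_nth_sum: "c0_nth (sum f A) n = (\<Sum>a\<in>A. c0_nth (f a) n)"
  by (induction A rule: infinite_finite_induct) (simp_all add: zero_c0.rep_eq plus_c0.rep_eq)

lemma norm_c0_unit: "norm (c0_unit k) = 1"
proof (rule antisym)
  show "norm (c0_unit k) \<le> 1"
    by (rule norm_c0_le) (simp add: c0_unit.rep_eq)
  show "1 \<le> norm (c0_unit k)"
    using c0_nth_le_norm[of "c0_unit k" k] by (simp add: c0_unit.rep_eq)
qed

section \<open>The group of sign changes\<close>

context twisted_sign_changes
begin

definition \<phi> :: "nat \<Rightarrow> c0 \<Rightarrow> real" where
  "\<phi> k x = c0_nth x k + (\<Sum>i<r. F k i * c0_nth x i)"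

definition flip_fun :: "nat set \<Rightarrow> c0 \<Rightarrow> c0" where
  "flip_fun A x = x - (\<Sum>k\<in>A. (2 * \<phi> k x) *\<^sub>R c0_unit k)"

definition flip :: "nat set \<Rightarrow> c0 \<Rightarrow>\<^sub>L c0" where
  "flip A = Blinfun (flip_fun A)"

definition flips :: "(c0 \<Rightarrow>\<^sub>L c0) set" where
  "flips = flip ` {A. finite A \<and> A \<subseteq> {r..}}"

lemma \<phi>_add: "\<phi> k (x + y) = \<phi> k x + \<phi> k y"
  by (simp add: \<phi>_def plus_c0.rep_eq algebra_simps sum.distrib)

lemma \<phi>_scaleR: "\<phi> k (c *\<^sub>R x) = c * \<phi> k x"
  by (simp add: \<phi>_def scaleR_c0.rep_eq algebra_simps sum_distrib_left)

lemma \<phi>_le: "\<bar>\<phi> k x\<bar> \<le> (1 + real r) * norm x"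
proof -
  have "\<bar>\<Sum>i<r. F k i * c0_nth x i\<bar> \<le> (\<Sum>i<r. 1 * norm x)"
    by (rule order_trans[OF sum_abs], rule sum_mono, unfold abs_mult, rule mult_mono)
       (auto simp: F_le c0_nth_le_norm)
  then show ?thesis
    using c0_nth_le_norm[of x k] by (simp add: \<phi>_def algebra_simps)
qed

lemma c0_nth_flip_fun:
  "finite A \<Longrightarrow> c0_nth (flip_fun A x) n = c0_nth x n - (if n \<in> A then 2 * \<phi> n x else 0)"
  by (simp add: flip_fun_def minus_c0.rep_eq c0_nth_sum scaleR_c0.rep_eq c0_unit.rep_eq if_distrib
      cong: if_cong)

text \<open>Each coordinate is corrected by at most its own term \<open>2 * \<phi> n x\<close>, so
  the bound does not depend on \<open>A\<close>. This makes the group bounded.\<close>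

lemma norm_flip_fun_le:
  assumes "finite A"
  shows "norm (flip_fun A x) \<le> norm x * (3 + 2 * real r)"
proof (rule norm_c0_le)
  fix n
  show "\<bar>c0_nth (flip_fun A x) n\<bar> \<le> norm x * (3 + 2 * real r)"
    using c0_nth_le_norm[of x n] \<phi>_le[of n x]
    by (auto simp: c0_nth_flip_fun assms algebra_simps)
qed

lemma flip_apply:
  assumes "finite A"
  shows "blinfun_apply (flip A) = flip_fun A"
  unfolding flip_def
proof (rule bounded_linear_Blinfun_apply, rule bounded_linear_intro[OF _ _ norm_flip_fun_le[OF assms]])
  show "flip_fun A (x + y) = flip_fun A x + flip_fun A y" for x y
    by (simp add: flip_fun_def \<phi>_add sum.distrib algebra_simps)
  show "flip_fun A (c *\<^sub>R x) = c *\<^sub>R flip_fun A x" for c x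
    by (simp add: flip_fun_def \<phi>_scaleR scaleR_right_diff_distrib scaleR_right.sum mult.left_commute)
qed

lemma c0_nth_flip:
  "finite A \<Longrightarrow> c0_nth (flip A x) n = c0_nth x n - (if n \<in> A then 2 * \<phi> n x else 0)"
  by (simp add: flip_apply c0_nth_flip_fun)

text \<open>As \<open>A\<close> avoids the indices below \<open>r\<close>, the sum in
  \<open>\<phi> k\<close> is unaffected; only the term \<open>c0_nth x k\<close> can change, by
  \<open>- 2 * \<phi> k x\<close>.\<close>

lemma \<phi>_flip:
  assumes "finite A" "A \<subseteq> {r..}"
  shows "\<phi> k (flip A x) = (if k \<in> A then - \<phi> k x else \<phi> k x)"
proof -
  have "(\<Sum>i<r. F k i * c0_nth (flip A x) i) = (\<Sum>i<r. F k i * c0_nth x i)"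
    using assms by (intro sum.cong) (auto simp: c0_nth_flip)
  then show ?thesis
    by (simp add: \<phi>_def[of k "flip A x"] c0_nth_flip assms) (simp add: \<phi>_def)
qed

text \<open>At an index in both sets the second correction has the opposite sign and cancels the
  first. Hence every element of the group is its own inverse.\<close>

lemma flip_compose:
  assumes "finite A" "A \<subseteq> {r..}" "finite B" "B \<subseteq> {r..}"
  shows "flip A o\<^sub>L flip B = flip (sym_diff A B)"
  by (rule blinfun_eqI, rule c0_eqI) (simp add: c0_nth_flip \<phi>_flip assms)

lemma flip_empty: "flip {} = id_blinfun"
  by (rule blinfun_eqI, rule c0_eqI) (simp add: c0_nth_flip)

lemma subgroup_flips: "subgroup flips GL"
proof (rule group.subgroupI[OF group_GL])
  have inv: "flip A o\<^sub>L flip A = id_blinfun" if "finite A" "A \<subseteq> {r..}" for A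
    using flip_compose[of A A] that by (simp add: flip_empty)
  show sub: "flips \<subseteq> carrier GL"
    using inv by (auto simp: flips_def GL_def)
  show "flips \<noteq> {}"
    by (auto simp: flips_def)
  show "inv\<^bsub>GL\<^esub> T \<in> flips" if "T \<in> flips" for T
  proof -
    have "T \<otimes>\<^bsub>GL\<^esub> T = \<one>\<^bsub>GL\<^esub>"
      using inv that by (auto simp: flips_def GL_def)
    then have "inv\<^bsub>GL\<^esub> T = T"
      using group.inv_equality[OF group_GL] sub that by blast
    with that show ?thesis by simp
  qed
  show "S \<otimes>\<^bsub>GL\<^esub> T \<in> flips" if "S \<in> flips" "T \<in> flips" for S T
  proof -
    obtain A B where "S = flip A" "T = flip B" "finite A" "A \<subseteq> {r..}" "finite B" "B \<subseteq> {r..}"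
      using \<open>S \<in> flips\<close> \<open>T \<in> flips\<close> by (auto simp: flips_def)
    then show ?thesis
      by (auto simp: flips_def GL_def flip_compose intro!: imageI)
  qed
qed

lemma bounded_flips: "bounded flips"
proof (rule boundedI)
  fix T assume "T \<in> flips"
  then obtain A where "T = flip A" "finite A"
    by (auto simp: flips_def)
  then show "norm T \<le> 3 + 2 * real r"
    using norm_flip_fun_le by (intro norm_blinfun_bound) (simp_all add: flip_apply mult.commute)
qed

section \<open>Separation and discreteness\<close>

lemma \<phi>_unit:
  assumes "i < r" "k \<ge> r"
  shows "\<phi> k (c0_unit i) = F k i"
  using assms by (simp add: \<phi>_def c0_unit.rep_eq if_distrib cong: if_cong)

text \<open>At a \<open>k\<close> in just one of the sets, the images of \<open>c0_unit i\<close>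
  differ in coordinate \<open>k\<close> by \<open>2 * \<bar>F k i\<bar>\<close>, and some
  \<open>i\<close> makes this 2. The uniform gap yields infinitude, discreteness and the
  distinguished family.\<close>

lemma flips_separated:
  assumes "finite A" "A \<subseteq> {r..}" "finite B" "B \<subseteq> {r..}" "A \<noteq> B"
  shows "\<exists>i<r. 2 \<le> norm (flip A (c0_unit i) - flip B (c0_unit i))"
proof -
  obtain k where k: "k \<in> A \<and> k \<notin> B \<or> k \<in> B \<and> k \<notin> A"
    using assms by blast
  then have "k \<ge> r"
    using assms by auto
  obtain i where i: "i < r" "\<bar>F k i\<bar> = 1"
    using F_eq by blast
  have "\<bar>c0_nth (flip A (c0_unit i) - flip B (c0_unit i)) k\<bar> = 2"
    using k i \<open>k \<ge> r\<close> by (auto simp: minus_c0.rep_eq c0_nth_flip assms \<phi>_unit abs_mult)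
  with i(1) show ?thesis
    using c0_nth_le_norm by metis
qed

lemma infinite_flips: "infinite flips"
proof -
  have "inj_on flip ((\<lambda>k. {k}) ` {r..})"
  proof (rule inj_onI, rule ccontr)
    fix A B assume "A \<in> (\<lambda>k. {k}) ` {r..}" "B \<in> (\<lambda>k. {k}) ` {r..}" "flip A = flip B" "A \<noteq> B"
    then show False
      using flips_separated[of A B] by auto
  qed
  moreover have "infinite ((\<lambda>k. {k}) ` {r..})"
    by (simp add: finite_image_iff infinite_Ici)
  ultimately have "infinite (flip ` (\<lambda>k. {k}) ` {r..})"
    by (simp add: finite_image_iff)
  moreover have "flip ` (\<lambda>k. {k}) ` {r..} \<subseteq> flips"
    by (auto simp: flips_def)
  ultimately show ?thesis
    using finite_subset by blast
qed

lemma SOT_discrete_flips: "SOT_discrete flips"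
  unfolding SOT_discrete_def
proof (rule sym, subst discrete_topology_unique, intro conjI ballI)
  show "topspace (subtopology strong_operator_topology flips) = flips"
    by (simp add: strong_operator_topology_topspace)
  fix T assume T: "T \<in> flips"
  then obtain A where A: "T = flip A" "finite A" "A \<subseteq> {r..}"
    by (auto simp: flips_def)
  \<comment> \<open>Radius 2 is the gap of \<open>flips_separated\<close>, so no other group element
    lies in \<open>U\<close>.\<close>
  define U where "U = {S. \<forall>i\<in>{..<r}. blinfun_apply S (c0_unit i) \<in> ball (T (c0_unit i)) 2}"
  have "openin strong_operator_topology U"
    unfolding U_def by (rule strong_operator_topology_basis) auto
  moreover have "U \<inter> flips = {T}"
  proof
    show "U \<inter> flips \<subseteq> {T}"
    proof
      fix S assume S: "S \<in> U \<inter> flips"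
      then obtain B where B: "S = flip B" "finite B" "B \<subseteq> {r..}"
        by (auto simp: flips_def)
      show "S \<in> {T}"
        using S A B flips_separated[of A B] by (force simp: U_def dist_norm)
    qed
    show "{T} \<subseteq> U \<inter> flips"
      using T by (auto simp: U_def)
  qed
  ultimately show "openin (subtopology strong_operator_topology flips) {T}"
    by (metis openin_subtopology)
qed

lemma flips_finite_rank:
  assumes "T \<in> flips"
  shows "\<exists>E. finite_rank E \<and> T = id_blinfun + E"
proof -
  obtain A where A: "T = flip A" "finite A"
    using assms by (auto simp: flips_def)
  have "(T - id_blinfun) x \<in> span (c0_unit ` A)" for x
  proof -
    have "(T - id_blinfun) x = - (\<Sum>k\<in>A. (2 * \<phi> k x) *\<^sub>R c0_unit k)"
      using A by (simp add: blinfun.diff_left flip_apply flip_fun_def)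
    then show ?thesis
      by (simp only:) (intro span_neg span_sum span_scale span_base imageI)
  qed
  then have "finite_rank (T - id_blinfun)"
    unfolding finite_rank_def using A(2) by (intro exI[of _ "c0_unit ` A"]) auto
  then show ?thesis
    by (intro exI[of _ "T - id_blinfun"]) simp
qed

section \<open>Distinguished families\<close>

lemma distinguished_flips: "distinguished flips (c0_unit ` {..<r})"
proof -
  have "ereal 2 \<le> ereal (MAX x\<in>c0_unit ` {..<r}. norm (blinfun_apply T x - x))" if T: "T \<in> flips - {id_blinfun}" for T
  proof -
    obtain A where A: "T = flip A" "finite A" "A \<subseteq> {r..}" "A \<noteq> {}"
      using T flip_empty by (auto simp: flips_def elim!: imageE)
    then obtain i where "i < r" "2 \<le> norm (T (c0_unit i) - c0_unit i)"
      \<comment> \<open>The identity is the sign change on the empty set.\<close>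
      using flips_separated[of A "{}"] by (auto simp: flip_empty)
    then show ?thesis
      by (auto intro: order_trans Max_ge)
  qed
  then have "ereal 2 \<le> (INF T\<in>flips - {id_blinfun}. ereal (MAX x\<in>c0_unit ` {..<r}. norm (blinfun_apply T x - x)))"
    by (rule INF_greatest)
  then have "0 < (INF T\<in>flips - {id_blinfun}. ereal (MAX x\<in>c0_unit ` {..<r}. norm (blinfun_apply T x - x)))"
    by (rule less_le_trans[rotated]) simp
  moreover have "c0_unit ` {..<r} \<noteq> {}"
    using r_pos by auto
  ultimately show ?thesis
    unfolding distinguished_def by blast
qed

lemma card_units: "card (c0_unit ` {..<r}) = r"
proof -
  have "inj c0_unit"
    by (rule injI) (metis c0_unit.rep_eq zero_neq_one)
  then show ?thesis
    by (simp add: card_image inj_on_subset)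
qed

text \<open>Choose \<open>v\<close> on the sphere orthogonal to the first \<open>r\<close>
  coordinates of each \<open>x\<close> in \<open>X\<close>. For large \<open>k\<close> with
  \<open>F k\<close> near \<open>v\<close>, both summands of \<open>\<phi> k x\<close> are
  small.\<close>

lemma small_\<phi>:
  assumes "finite X" "card X < r" "e > 0"
  shows "\<exists>k\<ge>r. \<forall>x\<in>X. \<bar>\<phi> k x\<bar> < e"
proof -
  obtain u where u: "\<exists>i\<in>{..<r}. u i \<noteq> 0" "\<And>x. x \<in> X \<Longrightarrow> (\<Sum>i<r. c0_nth x i * u i) = 0"
    using underdetermined_system_nontrivial[of X "{..<r}" c0_nth] assms by auto
  define m where "m = (MAX i\<in>{..<r}. \<bar>u i\<bar>)"
  have m_ge: "\<bar>u i\<bar> \<le> m" if "i < r" for i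
    using that by (simp add: m_def)
  have "m \<in> (\<lambda>i. \<bar>u i\<bar>) ` {..<r}"
    unfolding m_def using r_pos by (intro Max_in) auto
  then obtain p where p: "p < r" "\<bar>u p\<bar> = m"
    by auto
  have m_pos: "m > 0"
    using u(1) m_ge by (force simp: less_le_trans)
  \<comment> \<open>Dividing by the max-norm puts \<open>v\<close> on the sphere, where
    \<open>F_dense\<close> applies.\<close>
  define v where "v i = u i / m" for i
  have v: "\<And>i. i < r \<Longrightarrow> \<bar>v i\<bar> \<le> 1" "\<exists>i<r. \<bar>v i\<bar> = 1"
    using m_ge m_pos p by (auto simp: v_def intro!: exI[of _ p])
  have v_ker: "(\<Sum>i<r. v i * c0_nth x i) = 0" if "x \<in> X" for x
    using u(2)[OF that] by (simp add: v_def mult.commute flip: sum_divide_distrib)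
  define C where "C = 1 + (\<Sum>x\<in>X. norm x)"
  have C: "C > 0" "\<And>x. x \<in> X \<Longrightarrow> norm x \<le> C"
  proof -
    show "C > 0"
      unfolding C_def by (intro add_pos_nonneg sum_nonneg) auto
    show "norm x \<le> C" if "x \<in> X" for x
      using member_le_sum[of x X norm] assms(1) that by (simp add: C_def)
  qed
  \<comment> \<open>The \<open>r\<close> error terms, each at most \<open>d * C\<close>, use up
    \<open>e / 2\<close>; the other half is left for \<open>c0_nth x k\<close>.\<close>
  define d where "d = e / (2 * real r * C)"
  have d: "d > 0"
    using assms(3) C r_pos by (simp add: d_def)
  have "\<forall>\<^sub>F k in sequentially. \<forall>x\<in>X. \<bar>c0_nth x k\<bar> < e / 2"
    using assms(1)
  proof (rule eventually_ball_finite, intro ballI)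
    show "\<forall>\<^sub>F k in sequentially. \<bar>c0_nth x k\<bar> < e / 2" for x
      using tendstoD[OF c0_nth_tendsto, of "e / 2" x] assms(3) by simp
  qed
  then obtain N where N: "\<And>k x. k \<ge> N \<Longrightarrow> x \<in> X \<Longrightarrow> \<bar>c0_nth x k\<bar> < e / 2"
    by (auto simp: eventually_sequentially)
  obtain k where k: "k \<ge> max N r" "\<And>i. i < r \<Longrightarrow> \<bar>F k i - v i\<bar> < d"
    using F_dense[OF v d] unfolding infinite_nat_iff_unbounded_le by blast
  have "\<bar>\<phi> k x\<bar> < e" if x: "x \<in> X" for x
  proof -
    \<comment> \<open>Orthogonality to \<open>v\<close> allows replacing \<open>F k\<close> by the
      small difference from \<open>v\<close>.\<close>
    have "(\<Sum>i<r. F k i * c0_nth x i) = (\<Sum>i<r. (F k i - v i) * c0_nth x i)"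
      using v_ker[OF x] by (simp add: algebra_simps sum_subtractf)
    also have "\<bar>\<dots>\<bar> \<le> (\<Sum>i<r. d * C)"
    proof (rule order_trans[OF sum_abs], rule sum_mono, unfold abs_mult, rule mult_mono)
      show "\<bar>F k i - v i\<bar> \<le> d" if "i \<in> {..<r}" for i
        using k(2)[of i] that by simp
      show "\<bar>c0_nth x i\<bar> \<le> C" for i
        using c0_nth_le_norm C(2)[OF x] order_trans by blast
    qed (use d in auto)
    also have "\<dots> = e / 2"
      using C r_pos by (simp add: d_def)
    finally show ?thesis
      using N[of k x] k(1) x by (simp add: \<phi>_def)
  qed
  with k(1) show ?thesis
    by auto
qed

text \<open>The sign change at a single \<open>k\<close> moves \<open>x\<close> by exactly
  \<open>2 * \<bar>\<phi> k x\<bar>\<close>, so \<open>small_\<phi>\<close> pushes the infimum below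
  every positive \<open>e\<close>.\<close>

lemma not_distinguished_flips:
  assumes "card X < r"
  shows "\<not> distinguished flips X"
proof
  assume dist: "distinguished flips X"
  \<comment> \<open>The bound on \<open>card X\<close> does not give finiteness, as infinite sets
    have cardinality 0 here.\<close>
  then have X: "finite X" "X \<noteq> {}"
    by (auto simp: distinguished_def)
  define I where "I = (INF T\<in>flips - {id_blinfun}. ereal (MAX x\<in>X. norm (blinfun_apply T x - x)))"
  have "I \<le> ereal e" if e: "e > 0" for e
  proof -
    obtain k where k: "k \<ge> r" "\<And>x. x \<in> X \<Longrightarrow> \<bar>\<phi> k x\<bar> < e / 2"
      using small_\<phi>[of X "e / 2"] X(1) assms e by auto
    have "flip {k} \<noteq> flip {}"
      using flips_separated[of "{k}" "{}"] k(1) by auto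
    then have "flip {k} \<in> flips - {id_blinfun}"
      using k(1) by (auto simp: flips_def flip_empty)
    then have "I \<le> ereal (MAX x\<in>X. norm (flip {k} x - x))"
      unfolding I_def by (rule INF_lower)
    also have "\<dots> \<le> ereal e"
    proof -
      have "norm (flip {k} x - x) \<le> e" if "x \<in> X" for x
      proof -
        have "norm (flip {k} x - x) = 2 * \<bar>\<phi> k x\<bar>"
          by (simp add: flip_apply flip_fun_def norm_c0_unit)
        then show ?thesis
          using k(2)[OF that] by simp
      qed
      then show ?thesis
        using X by simp
    qed
    finally show ?thesis .
  qed
  then have "I \<le> 0"
    by - (rule ereal_le_epsilon2, simp)
  moreover have "0 < I"
    using dist by (simp add: distinguished_def I_def)
  ultimately show False
    by simp
qed

end

theorem proposition6p1:
  fixes r :: nat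
  assumes "r \<ge> 2"
  shows "\<exists>G :: (c0 \<Rightarrow>\<^sub>L c0) set.
    subgroup G GL \<and> bounded G \<and> infinite G \<and> SOT_discrete G \<and>
    (\<forall>T\<in>G. \<exists>F. finite_rank F \<and> T = id_blinfun + F) \<and>
    (\<exists>X. card X = r \<and> distinguished G X) \<and>
    \<not> (\<exists>X. card X = r - 1 \<and> distinguished G X)"
proof -
  have r: "r > 0"
    using assms by simp
  obtain F where "twisted_sign_changes r F"
    by (rule exists_twisted_sign_changes[OF r])
  then interpret twisted_sign_changes r F .
  have "\<not> (\<exists>X. card X = r - 1 \<and> distinguished flips X)"
    using not_distinguished_flips r by auto
  then show ?thesis
    using subgroup_flips bounded_flips infinite_flips SOT_discrete_flips flips_finite_rank
      distinguished_flips card_units by blast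
qed

end
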